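(* For every integer $n\ge 1$, the free sum $A_3\oplus A_1^{\oplus n}$ is a CL-polytope.
   Context: $A_d=\mathrm{conv}(\{\pm(e_i+e_{i+1}+\dots+e_j):1\le i\le j\le d\})\subset\mathbb{R}^d$ is the root polytope of type A. For polytopes $Q_1\subset\mathbb{R}^{d_1},Q_2\subset\mathbb{R}^{d_2}$ containing the origin, $Q_1\oplus Q_2=\mathrm{conv}((Q_1\times\{0\})\cup(\{0\}\times Q_2))\subset\mathbb{R}^{d_1+d_2}$, and $Q^{\oplus n}$ is the $n$-fold free sum of $Q$ with itself. For an integral full-dimensional polytope $Q\subset\mathbb{R}^d$, $E_Q(k)=\#(kQ\cap\mathbb{Z}^d)$ is its Ehrhart polynomial. A reflexive polytope is CL if all roots of its Ehrhart polynomial lie on the line $\mathrm{Re}(z)=-\tfrac12$ in $\mathbb{C}$. *)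

theory Defs
  imports "HOL-Analysis.Analysis" "HOL-Computational_Algebra.Polynomial"
begin

text \<open>
  The ambient spaces are arbitrary Euclidean spaces, with \<open>'a \<times> 'b\<close> in place of the space of
  dimension \<open>d1 + d2\<close>. On \<open>\<real>\<^sup>d\<close>, products and iterated vector types, \<^const>\<open>Basis\<close> is the
  standard basis, so the set below is the lattice \<open>\<int>\<^sup>d\<close>.
\<close>

definition integer_points :: "'a::euclidean_space set" where
  "integer_points = {x. \<forall>b\<in>Basis. x \<bullet> b \<in> \<int>}"

definition integral_polytope :: "'a::euclidean_space set \<Rightarrow> bool" where
  "integral_polytope Q \<longleftrightarrow> polytope Q \<and> (\<forall>v. v extreme_point_of Q \<longrightarrow> v \<in> integer_points)"

definition dual_polytope :: "'a::euclidean_space set \<Rightarrow> 'a set" where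
  "dual_polytope Q = {y. \<forall>x\<in>Q. x \<bullet> y \<le> 1}"

definition reflexive :: "'a::euclidean_space set \<Rightarrow> bool" where
  "reflexive Q \<longleftrightarrow> integral_polytope Q \<and> 0 \<in> interior Q \<and> integral_polytope (dual_polytope Q)"

text \<open>
  The counting function agrees with a unique polynomial at all positive integers whenever \<open>Q\<close> is an
  integral polytope (Ehrhart); the definition is meaningful only for such \<open>Q\<close>. Coefficients are
  taken in the complex numbers because the complex roots are of interest.
\<close>

definition ehrhart_poly :: "'a::euclidean_space set \<Rightarrow> complex poly" where
  "ehrhart_poly Q = (THE p. \<forall>k::nat. k \<ge> 1 \<longrightarrow>
     poly p (of_nat k) = of_nat (card ((\<lambda>x. real k *\<^sub>R x) ` Q \<inter> integer_points)))"

definition CL_polytope :: "'a::euclidean_space set \<Rightarrow> bool" where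
  "CL_polytope Q \<longleftrightarrow> reflexive Q \<and> (\<forall>z. poly (ehrhart_poly Q) z = 0 \<longrightarrow> Re z = - 1/2)"

definition free_sum :: "'a::euclidean_space set \<Rightarrow> 'b::euclidean_space set \<Rightarrow> ('a \<times> 'b) set" where
  "free_sum Q1 Q2 = convex hull ((Q1 \<times> {0}) \<union> ({0} \<times> Q2))"

text \<open>
  The \<open>n\<close>-fold free sum of \<open>Q\<close> with itself, where \<open>n\<close> is the cardinality of the index type \<open>'n\<close> and
  \<open>'a ^ 'n\<close> plays the role of \<open>(\<real>\<^sup>d)\<^sup>n\<close>: the convex hull of the copies of \<open>Q\<close> in each of the
  \<open>n\<close> blocks. The lemmas \<open>free_power_one\<close> and \<open>free_power_Suc\<close> below confirm that this is
  the iterated binary free sum.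
\<close>

definition free_power :: "'a::euclidean_space set \<Rightarrow> ('a ^ 'n) set" where
  "free_power Q = convex hull (\<Union>i. axis i ` Q)"

lemma free_power_one:
  fixes Q :: "'a::euclidean_space set"
  assumes "convex Q"
  shows "(free_power Q :: ('a ^ 1) set) = (\<lambda>x. \<chi> i. x) ` Q"
proof -
  have *: "axis i x = ((\<chi> i. x) :: 'a ^ 1)" for i x
    by (simp add: vec_eq_iff axis_def)
  have "linear (\<lambda>x::'a. (\<chi> i. x) :: 'a ^ 1)"
    by (auto intro!: linearI simp: vec_eq_iff)
  then have "convex ((\<lambda>x. (\<chi> i. x) :: 'a ^ 1) ` Q)"
    using assms by (rule convex_linear_image)
  then show ?thesis
    unfolding free_power_def * by (simp add: convex_hull_eq)
qed

lemma free_power_Suc: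
  fixes Q :: "'a::euclidean_space set"
  defines "glue \<equiv> (\<lambda>(x, y). \<chi> i. case i of None \<Rightarrow> x | Some j \<Rightarrow> y $ j)
                    :: 'a \<times> ('a ^ 'n) \<Rightarrow> 'a ^ 'n option"
  shows "linear glue" and "bij glue"
    and "glue ` free_sum Q (free_power Q) = free_power Q"
proof -
  show lin: "linear glue"
    by (rule linearI) (auto simp: glue_def vec_eq_iff split: option.split)
  show "bij glue"
  proof (rule bijI)
    show "inj glue"
    proof (rule injI)
      fix p q assume eq: "glue p = glue q"
      have "fst p = fst q"
        using arg_cong[OF eq, of "\<lambda>v. v $ None"] by (simp add: glue_def split_beta)
      moreover have "snd p $ j = snd q $ j" for j
        using arg_cong[OF eq, of "\<lambda>v. v $ Some j"] by (simp add: glue_def split_beta)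
      ultimately show "p = q" by (simp add: prod_eq_iff vec_eq_iff)
    qed
    show "surj glue"
    proof (rule surjI)
      fix v :: "'a ^ 'n option"
      show "glue (v $ None, \<chi> j. v $ Some j) = v"
        by (auto simp: glue_def vec_eq_iff split: option.split)
    qed
  qed
  let ?C = "\<Union>i::'n. axis i ` Q"
  have g1: "glue (x, 0) = axis None x" for x
    by (auto simp: glue_def vec_eq_iff axis_def split: option.split)
  have g2: "glue (0, axis j x) = axis (Some j) x" for j x
    by (auto simp: glue_def vec_eq_iff axis_def split: option.split)
  have linp: "linear (\<lambda>y. glue (0, y))"
    by (rule linearI) (auto simp: glue_def vec_eq_iff split: option.split)
  have "glue ` free_sum Q (free_power Q)
      = convex hull (glue ` (Q \<times> {0}) \<union> (\<lambda>y. glue (0, y)) ` (convex hull ?C))"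
    unfolding free_sum_def free_power_def convex_hull_linear_image[OF lin]
    by (rule arg_cong[where f = "\<lambda>S. convex hull S"]) auto
  also have "(\<lambda>y. glue (0, y)) ` (convex hull ?C) = convex hull ((\<lambda>y. glue (0, y)) ` ?C)"
    by (rule convex_hull_linear_image[OF linp])
  also have "convex hull (glue ` (Q \<times> {0}) \<union> convex hull ((\<lambda>y. glue (0, y)) ` ?C))
      = convex hull (glue ` (Q \<times> {0}) \<union> ((\<lambda>y. glue (0, y)) ` ?C))"
    by (rule hull_Un_right[symmetric])
  also have "glue ` (Q \<times> {0}) \<union> ((\<lambda>y. glue (0, y)) ` ?C) = (\<Union>i. axis i ` Q)"
  proof -
    have "glue ` (Q \<times> {0}) = axis None ` Q" by (force simp: g1)
    moreover have "(\<lambda>y. glue (0, y)) ` ?C = (\<Union>j. axis (Some j) ` Q)"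
      by (simp add: image_UN image_image g2)
    ultimately show ?thesis by (simp add: UNIV_option_conv)
  qed
  finally show "glue ` free_sum Q (free_power Q) = free_power Q"
    unfolding free_power_def .
qed

text \<open>
  The coordinates of \<open>\<real>\<^sup>d\<close> are indexed by a linearly ordered type with \<open>d\<close> elements, such as a
  numeral type, in place of \<open>{1..d}\<close>; \<open>axis k 1\<close> is the unit vector \<open>e\<^sub>k\<close>.
\<close>

definition root_polytope_A :: "(real ^ 'd::{finite,linorder}) set" where
  "root_polytope_A = convex hull
     (\<Union>(i, j) \<in> {(i, j). i \<le> j}. {\<Sum>k\<in>{i..j}. axis k 1, - (\<Sum>k\<in>{i..j}. axis k 1)})"

end

theory Submission
  imports Defs
begin

text \<open>The free sum \<open>Q\<close> is the unit ball of a gauge \<open>N x + \<Sum>\<^sub>i \<bar>t\<^sub>i\<bar>\<close>, which is at the same time the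
  support function of a finite set of lattice points; these are then the vertices of the dual, and \<open>Q\<close> is
  reflexive.

  The number of lattice points of the \<open>k\<close>-th dilate of the \<open>m\<close>-dimensional cross-polytope is the Delannoy
  number \<open>D m k\<close>. The \<open>h\<^sup>*\<close>-polynomial of \<open>Q\<close> is
  \<open>(1 + 9 z + 9 z\<^sup>2 + z\<^sup>3) (1 + z)\<^sup>n = (1 + z)\<^sup>n\<^sup>+\<^sup>1 (5 / 2 (1 + z)\<^sup>2 - 3 / 2 (1 - z)\<^sup>2)\<close>, so that
  \<open>E k = 5 / 2 D (n + 3) k - 3 / 2 D (n + 1) k\<close>. By the three-term recurrence
  \<open>(m + 2) D (m + 2) k = (2 k + 1) D (m + 1) k + (m + 1) D m k\<close>, the ratio of consecutive Delannoy
  polynomials at \<open>z\<close> has a real part of the same sign as \<open>2 Re z + 1\<close>; hence neither they nor \<open>E\<close> vanish off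
  the line \<open>Re z = - 1 / 2\<close>.\<close>

section \<open>Polytopes given by a gauge that is a support function\<close>

lemma integral_polytope_convex_hull:
  assumes "finite V" "V \<subseteq> integer_points"
  shows "integral_polytope (convex hull V)"
  using assms extreme_point_of_convex_hull unfolding integral_polytope_def polytope_def by blast

text \<open>Two descriptions of one function: \<open>gauge_le_1\<close> and
  \<open>inner_le_gauge\<close> tie \<open>\<nu>\<close> to the hull of \<open>V\<close>, the second
  by duality, which avoids writing points as combinations of vertices; the last two make
  \<open>\<nu>\<close> the maximum of the functionals in \<open>W\<close>.\<close>

locale support_gauge =
  fixes V W :: "'a::euclidean_space set" and \<nu> :: "'a \<Rightarrow> real"
  assumes finite_V: "finite V" and finite_W: "finite W"
    and zero_in_hull: "0 \<in> convex hull V"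
    and gauge_le_1: "v \<in> V \<Longrightarrow> \<nu> v \<le> 1"
    and inner_le_gauge: "(\<And>v. v \<in> V \<Longrightarrow> u \<bullet> v \<le> \<beta>) \<Longrightarrow> u \<bullet> z \<le> \<beta> * \<nu> z"
    and support_le: "w \<in> W \<Longrightarrow> w \<bullet> z \<le> \<nu> z"
    and support_attained: "\<exists>w\<in>W. w \<bullet> z = \<nu> z"
begin

lemma gauge_le_iff: "\<nu> z \<le> c \<longleftrightarrow> (\<forall>w\<in>W. w \<bullet> z \<le> c)"
  using support_le[of _ z] support_attained[of z] by force

lemma gauge_less_iff: "\<nu> z < c \<longleftrightarrow> (\<forall>w\<in>W. w \<bullet> z < c)"
  using support_le[of _ z] support_attained[of z] by force

lemma gauge_nonneg: "\<nu> z \<ge> 0"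
  using inner_le_gauge[of 0 1 z] by simp

lemma gauge_zero: "\<nu> 0 = 0"
  using support_attained[of 0] by auto

lemma gauge_scaleR_le_iff: "c > 0 \<Longrightarrow> \<nu> (c *\<^sub>R z) \<le> c * d \<longleftrightarrow> \<nu> z \<le> d"
  by (simp add: gauge_le_iff)

text \<open>Sublevel sets of \<open>\<nu>\<close> are intersections of half-spaces; conversely, a
  hyperplane separating a point of the unit ball from the hull would contradict
  \<open>inner_le_gauge\<close>.\<close>

lemma convex_hull_eq_gauge: "convex hull V = {z. \<nu> z \<le> 1}"
proof
  have "{z. \<nu> z \<le> 1} = (\<Inter>w\<in>W. {z. w \<bullet> z \<le> 1})"
    by (auto simp: gauge_le_iff)
  then have "convex {z. \<nu> z \<le> 1}"
    by (simp add: convex_INT convex_halfspace_le)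
  then show "convex hull V \<subseteq> {z. \<nu> z \<le> 1}"
    by (intro hull_minimal) (auto simp: gauge_le_1)
next
  show "{z. \<nu> z \<le> 1} \<subseteq> convex hull V"
  proof (intro subsetI, rule ccontr)
    fix z assume z: "z \<in> {z. \<nu> z \<le> 1}" and "z \<notin> convex hull V"
    moreover have "closed (convex hull V)"
      using finite_V by (simp add: compact_imp_closed finite_imp_compact_convex_hull)
    ultimately obtain a b where ab: "a \<bullet> z < b" "\<And>v. v \<in> convex hull V \<Longrightarrow> a \<bullet> v > b"
      using separating_hyperplane_closed_point[of "convex hull V" z] by auto
    have "(-a) \<bullet> z \<le> (-b) * \<nu> z"
    proof (rule inner_le_gauge)
      show "(-a) \<bullet> v \<le> -b" if "v \<in> V" for v
        using ab(2)[of v] that by (simp add: hull_inc)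
    qed
    \<comment> \<open>The sign matters: multiplying \<open>\<nu> z \<le> 1\<close> by
      \<open>b\<close> has to reverse it.\<close>
    moreover have "b < 0"
      using ab(2)[OF zero_in_hull] by simp
    then have "b * 1 \<le> b * \<nu> z"
      using z by (intro mult_left_mono_neg) auto
    ultimately show False
      using ab(1) by simp
  qed
qed

text \<open>A functional separating \<open>y\<close> from the hull of \<open>W\<close> rescales to a
  point of the unit ball of \<open>\<nu>\<close>, that is, of the hull of \<open>V\<close>, whose
  inner product with \<open>y\<close> exceeds 1.\<close>

lemma dual_polytope_hull: "dual_polytope (convex hull V) = convex hull W"
proof
  have "convex (dual_polytope (convex hull V))"
  proof -
    have "dual_polytope (convex hull V) = (\<Inter>x\<in>convex hull V. {y. x \<bullet> y \<le> 1})"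
      by (auto simp: dual_polytope_def)
    then show ?thesis
      by (simp add: convex_INT convex_halfspace_le)
  qed
  moreover have "W \<subseteq> dual_polytope (convex hull V)"
    by (auto simp: dual_polytope_def convex_hull_eq_gauge gauge_le_iff inner_commute)
  ultimately show "convex hull W \<subseteq> dual_polytope (convex hull V)"
    by (simp add: hull_minimal)
next
  show "dual_polytope (convex hull V) \<subseteq> convex hull W"
  proof (intro subsetI, rule ccontr)
    fix y assume y: "y \<in> dual_polytope (convex hull V)" and "y \<notin> convex hull W"
    moreover have "closed (convex hull W)"
      using finite_W by (simp add: compact_imp_closed finite_imp_compact_convex_hull)
    ultimately obtain a b where ab: "a \<bullet> y < b" "\<And>w. w \<in> convex hull W \<Longrightarrow> a \<bullet> w > b"
      using separating_hyperplane_closed_point[of "convex hull W" y] by auto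
    have less: "\<nu> (-a) < -b"
      unfolding gauge_less_iff using ab(2) by (force simp: hull_inc inner_commute)
    then have b: "-b > 0"
      using gauge_nonneg[of "-a"] by linarith
    have "\<nu> ((1 / -b) *\<^sub>R (-a)) \<le> (1 / -b) * (-b)"
      using gauge_scaleR_le_iff[of "1 / -b" "-a" "-b"] b less by simp
    then have "(1 / -b) *\<^sub>R (-a) \<in> convex hull V"
      using b by (simp add: convex_hull_eq_gauge)
    then have "((1 / -b) *\<^sub>R (-a)) \<bullet> y \<le> 1"
      using y unfolding dual_polytope_def by blast
    then show False
      using ab(1) b by (simp add: field_simps)
  qed
qed

text \<open>The strict inequalities \<open>w \<bullet> z < 1\<close> cut out an open neighbourhood
  of 0 inside the hull, and all extreme points of the dual lie in \<open>W\<close>.\<close>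

lemma reflexive_hull:
  assumes "V \<subseteq> integer_points" "W \<subseteq> integer_points"
  shows "reflexive (convex hull V)"
proof -
  have "open (\<Inter>w\<in>W. {z. w \<bullet> z < 1})"
    using finite_W by (intro open_INT ballI open_halfspace_lt)
  then have "(\<Inter>w\<in>W. {z. w \<bullet> z < 1}) \<subseteq> interior (convex hull V)"
    by (intro interior_maximal) (auto simp: convex_hull_eq_gauge gauge_le_iff less_imp_le)
  then have "0 \<in> interior (convex hull V)"
    by auto
  then show ?thesis
    using assms finite_V finite_W
    by (simp add: reflexive_def integral_polytope_convex_hull dual_polytope_hull)
qed

lemma scaled_hull:
  assumes "c > 0"
  shows "(\<lambda>x. c *\<^sub>R x) ` (convex hull V) = {z. \<nu> z \<le> c}"
proof (intro set_eqI iffI)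
  fix z assume "z \<in> {z. \<nu> z \<le> c}"
  then have "\<nu> (c *\<^sub>R (inverse c *\<^sub>R z)) \<le> c * 1"
    using assms by simp
  then have "inverse c *\<^sub>R z \<in> convex hull V"
    unfolding gauge_scaleR_le_iff[OF assms] by (simp add: convex_hull_eq_gauge)
  then show "z \<in> (\<lambda>x. c *\<^sub>R x) ` (convex hull V)"
    by (rule image_eqI[rotated]) (use assms in simp)
qed (use gauge_scaleR_le_iff[OF assms, of _ 1] in \<open>auto simp: convex_hull_eq_gauge\<close>)

end

section \<open>Gauges of free sums and free powers\<close>

lemma free_sum_convex_hull:
  fixes S :: "'a::euclidean_space set" and T :: "'b::euclidean_space set"
  shows "free_sum (convex hull S) (convex hull T) = convex hull (S \<times> {0} \<union> {0} \<times> T)"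
proof -
  have "(convex hull S) \<times> {0} = convex hull (S \<times> {0::'b})"
    by (simp add: convex_hull_Times)
  moreover have "{0} \<times> (convex hull T) = convex hull ({0::'a} \<times> T)"
    by (simp add: convex_hull_Times)
  ultimately show ?thesis
    unfolding free_sum_def by (simp only: hull_Un_left[symmetric] hull_Un_right[symmetric])
qed

lemma free_power_convex_hull:
  "(free_power (convex hull S) :: ('a::euclidean_space ^ 'n) set) = convex hull (\<Union>i. axis i ` S)"
proof -
  have lin: "linear (axis i :: 'a \<Rightarrow> 'a ^ 'n)" for i
    by (rule linearI) (simp_all add: vec_eq_iff axis_def)
  have "axis i ` (convex hull S) \<subseteq> convex hull (\<Union>i::'n. axis i ` S)" for i
    unfolding convex_hull_linear_image[OF lin] by (rule hull_mono) blast
  then have "free_power (convex hull S) \<subseteq> convex hull (\<Union>i::'n. axis i ` S)"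
    unfolding free_power_def by (intro hull_minimal) auto
  moreover have "convex hull (\<Union>i::'n. axis i ` S) \<subseteq> free_power (convex hull S)"
    unfolding free_power_def by (intro hull_mono UN_mono image_mono hull_subset) auto
  ultimately show ?thesis by auto
qed

text \<open>Free sums are polar to products: the two components of a functional are chosen
  independently, so the maximum of the sum is the sum of the maxima.\<close>

lemma support_gauge_free_sum:
  fixes V\<^sub>1 :: "'a::euclidean_space set" and V\<^sub>2 :: "'b::euclidean_space set"
  assumes "support_gauge V\<^sub>1 W\<^sub>1 \<nu>\<^sub>1" "support_gauge V\<^sub>2 W\<^sub>2 \<nu>\<^sub>2"
  shows "support_gauge (V\<^sub>1 \<times> {0} \<union> {0} \<times> V\<^sub>2) (W\<^sub>1 \<times> W\<^sub>2) (\<lambda>(x, y). \<nu>\<^sub>1 x + \<nu>\<^sub>2 y)"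
proof -
  interpret A: support_gauge V\<^sub>1 W\<^sub>1 \<nu>\<^sub>1 by fact
  interpret B: support_gauge V\<^sub>2 W\<^sub>2 \<nu>\<^sub>2 by fact
  show ?thesis
  proof
    have "(0, 0) \<in> convex hull (V\<^sub>1 \<times> {0 :: 'b})"
      by (simp add: convex_hull_Times A.zero_in_hull)
    then show "0 \<in> convex hull (V\<^sub>1 \<times> {0} \<union> {0} \<times> V\<^sub>2)"
      unfolding zero_prod_def by (rule set_mp[OF hull_mono, rotated]) blast
  next
    fix u z :: "'a \<times> 'b" and \<beta>
    assume u: "\<And>v. v \<in> V\<^sub>1 \<times> {0} \<union> {0} \<times> V\<^sub>2 \<Longrightarrow> u \<bullet> v \<le> \<beta>"
    have "fst u \<bullet> fst z \<le> \<beta> * \<nu>\<^sub>1 (fst z)"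
      using u[of "(_, 0)"] by (intro A.inner_le_gauge) (simp add: inner_prod_def)
    moreover have "snd u \<bullet> snd z \<le> \<beta> * \<nu>\<^sub>2 (snd z)"
      using u[of "(0, _)"] by (intro B.inner_le_gauge) (simp add: inner_prod_def)
    ultimately show "u \<bullet> z \<le> \<beta> * (case z of (x, y) \<Rightarrow> \<nu>\<^sub>1 x + \<nu>\<^sub>2 y)"
      by (simp add: inner_prod_def split_beta distrib_left)
  next
    fix w z assume "w \<in> W\<^sub>1 \<times> W\<^sub>2"
    then show "w \<bullet> z \<le> (case z of (x, y) \<Rightarrow> \<nu>\<^sub>1 x + \<nu>\<^sub>2 y)"
      by (auto simp: inner_prod_def split_beta intro!: add_mono A.support_le B.support_le)
  next
    fix z :: "'a \<times> 'b"
    obtain w\<^sub>1 w\<^sub>2 where "w\<^sub>1 \<in> W\<^sub>1" "w\<^sub>2 \<in> W\<^sub>2" "w\<^sub>1 \<bullet> fst z = \<nu>\<^sub>1 (fst z)" "w\<^sub>2 \<bullet> snd z = \<nu>\<^sub>2 (snd z)"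
      using A.support_attained B.support_attained by meson
    then show "\<exists>w\<in>W\<^sub>1 \<times> W\<^sub>2. w \<bullet> z = (case z of (x, y) \<Rightarrow> \<nu>\<^sub>1 x + \<nu>\<^sub>2 y)"
      by (intro bexI[of _ "(w\<^sub>1, w\<^sub>2)"]) (auto simp: inner_prod_def split_beta)
  qed (auto simp: A.finite_V A.finite_W B.finite_V B.finite_W A.gauge_le_1 B.gauge_le_1
      A.gauge_zero B.gauge_zero)
qed

text \<open>The argument for the free sum, applied to all blocks at once: a maximising functional is
  chosen in each block separately.\<close>

lemma support_gauge_free_power:
  fixes V :: "'a::euclidean_space set"
  assumes "support_gauge V W \<nu>"
  shows "support_gauge (\<Union>i. axis i ` V) {w :: 'a ^ 'n. \<forall>i. w $ i \<in> W} (\<lambda>x. \<Sum>i\<in>UNIV. \<nu> (x $ i))"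
proof -
  interpret support_gauge V W \<nu> by fact
  show ?thesis
  proof
    have "{w :: 'a ^ 'n. \<forall>i. w $ i \<in> W} \<subseteq> vec_lambda ` (UNIV \<rightarrow> W)"
      by (auto intro!: image_eqI[of _ _ "vec_nth _"])
    moreover have "finite ((UNIV :: 'n set) \<rightarrow> W)"
      using finite_PiE[of "UNIV :: 'n set" "\<lambda>_. W"] finite_W by (simp add: PiE_UNIV_domain)
    ultimately show "finite {w :: 'a ^ 'n. \<forall>i. w $ i \<in> W}"
      using finite_surj by blast
  next
    have "0 \<in> free_power (convex hull V)"
      unfolding free_power_def
      by (rule hull_inc) (auto intro!: exI[of _ undefined] image_eqI[OF _ zero_in_hull] simp: axis_def vec_eq_iff)
    then show "0 \<in> convex hull (\<Union>i::'n. axis i ` V)"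
      by (simp add: free_power_convex_hull)
  next
    fix x :: "'a ^ 'n" assume "x \<in> (\<Union>i. axis i ` V)"
    then obtain i v where v: "v \<in> V" "x = axis i v" by auto
    have "(\<Sum>j\<in>UNIV. \<nu> (x $ j)) = (\<Sum>j\<in>UNIV. if j = i then \<nu> v else 0)"
      by (rule sum.cong) (auto simp: v axis_def gauge_zero)
    then show "(\<Sum>j\<in>UNIV. \<nu> (x $ j)) \<le> 1"
      using gauge_le_1[OF v(1)] by simp
  next
    fix u z :: "'a ^ 'n" and \<beta>
    assume u: "\<And>v. v \<in> (\<Union>i. axis i ` V) \<Longrightarrow> u \<bullet> v \<le> \<beta>"
    have "u $ i \<bullet> z $ i \<le> \<beta> * \<nu> (z $ i)" for i
      using u by (intro inner_le_gauge) (force simp: inner_axis)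
    then show "u \<bullet> z \<le> \<beta> * (\<Sum>i\<in>UNIV. \<nu> (z $ i))"
      by (simp add: inner_vec_def sum_distrib_left sum_mono)
  next
    fix z :: "'a ^ 'n"
    have "\<forall>i. \<exists>w. w \<in> W \<and> w \<bullet> z $ i = \<nu> (z $ i)"
      using support_attained by blast
    then obtain w where "\<forall>i. w i \<in> W \<and> w i \<bullet> z $ i = \<nu> (z $ i)"
      by (rule choice[THEN exE])
    then show "\<exists>w\<in>{w :: 'a ^ 'n. \<forall>i. w $ i \<in> W}. w \<bullet> z = (\<Sum>i\<in>UNIV. \<nu> (z $ i))"
      by (intro bexI[of _ "\<chi> i. w i"]) (auto simp: inner_vec_def)
  qed (auto simp: finite_V inner_vec_def intro!: sum_mono support_le)
qed

section \<open>The gauges of the root polytopes\<close>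

text \<open>In the type \<open>3\<close> the numeral 3 equals 0 and the order is 0 < 1 < 2; the
  intervals in \<open>root_polytope_A\<close> are to be read with these representatives.\<close>

lemma UNIV_3_zero: "UNIV = {0, 1, 2 :: 3}"
  using UNIV_3 by auto

lemma forall_3_zero: "(\<forall>i::3. P i) \<longleftrightarrow> P 0 \<and> P 1 \<and> P 2"
  by (metis UNIV_3_zero UNIV_I insertE singletonD)

lemma less_3: "(0::3) < 1" "(1::3) < 2" "(0::3) < 2"
  by (simp_all add: less_bit1_def bit1.Rep_0 bit1.Rep_1 bit1.Rep_numeral)

lemma neq_3: "(0::3) \<noteq> 1" "(1::3) \<noteq> 2" "(0::3) \<noteq> 2" "(1::3) \<noteq> 0" "(2::3) \<noteq> 1" "(2::3) \<noteq> 0"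
  using less_3 by auto

lemma inner_3_zero: "x \<bullet> y = x $ 0 * y $ 0 + x $ 1 * y $ 1 + x $ 2 * y $ 2"
  for x y :: "real ^ 3"
  unfolding inner_vec_def UNIV_3_zero by (simp add: neq_3)

definition roots_A3 :: "(real ^ 3) set" where
  "roots_A3 = (let R = {axis 0 1, axis 1 1, axis 2 1, axis 0 1 + axis 1 1, axis 1 1 + axis 2 1,
     axis 0 1 + axis 1 1 + axis 2 1} in R \<union> uminus ` R)"

lemma root_polytope_A3: "root_polytope_A = convex hull roots_A3"
proof -
  have le: "(0::3) \<le> 1" "(1::3) \<le> 2" "(0::3) \<le> 2" "\<not> (1::3) \<le> 0" "\<not> (2::3) \<le> 1" "\<not> (2::3) \<le> 0"
    using less_3 by auto
  have "\<forall>i j. i \<le> j \<longleftrightarrow> (i, j) \<in> {(0, 0), (1, 1), (2, 2), (0, 1), (1, 2), (0, 2 :: 3)}"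
    unfolding forall_3_zero by (simp add: le neq_3)
  then have P: "{(i, j). i \<le> j} = {(0, 0), (1, 1), (2, 2), (0, 1), (1, 2), (0, 2 :: 3)}"
    by (simp add: set_eq_iff)
  have I: "{0..1::3} = {0, 1}" "{1..2::3} = {1, 2}" "{0..2::3} = {0, 1, 2}"
    by (simp_all add: set_eq_iff forall_3_zero le neq_3)
  show ?thesis
    unfolding root_polytope_A_def roots_A3_def P Let_def
    by (intro arg_cong[where f = "\<lambda>S. convex hull S"])
      (simp add: I neq_3 insert_commute algebra_simps)
qed

text \<open>In the coordinates \<open>y = (a, b - a, c - b, - c)\<close>, of sum zero, the roots are the differences of two
  unit vectors; the gauge is the sum of the positive parts of \<open>y\<close>, which is the maximum over all
  \<open>S\<close> of the sum of \<open>y\<close> over \<open>S\<close>.\<close>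

definition gauge_A3 :: "real ^ 3 \<Rightarrow> real" where
  "gauge_A3 x = max 0 (x $ 0) + max 0 (x $ 1 - x $ 0) + max 0 (x $ 2 - x $ 1) + max 0 (- x $ 2)"

text \<open>The tuple \<open>(p, q, r, s)\<close> is the indicator of a subset \<open>S\<close> of
  the four entries of \<open>y\<close>; the functional sums \<open>y\<close> over \<open>S\<close>,
  rewritten in the coordinates \<open>(a, b, c)\<close>.\<close>

definition dual_vertices_A3 :: "(real ^ 3) set" where
  "dual_vertices_A3 = (\<lambda>(p, q, r, s). (p - q) *\<^sub>R axis 0 1 + (q - r) *\<^sub>R axis 1 1 + (r - s) *\<^sub>R axis 2 1) `
     ({0, 1} \<times> {0, 1} \<times> {0, 1} \<times> {0, 1})"

lemma axis_3_nth: "(axis i 1 :: real ^ 3) $ j = (if i = j then 1 else 0)"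
  by (simp add: axis_def)

text \<open>The weight \<open>t - m\<close> lies between 0 and \<open>\<beta>\<close>, so it can be
  replaced by \<open>\<beta>\<close> where \<open>y\<close> is nonnegative and by 0 where it is
  negative.\<close>

lemma weighted_sum_le_positive_parts:
  fixes t y m \<beta> :: real
  assumes "m \<le> t" "t \<le> m + \<beta>"
  shows "(t - m) * y \<le> \<beta> * max 0 y"
proof (cases "y \<ge> 0")
  case True
  then show ?thesis
    using assms by (simp add: max_def mult_right_mono)
next
  case False
  then show ?thesis
    using assms by (simp add: max_def mult_nonneg_nonpos)
qed

lemma of_bool_times_eq_max: "of_bool (y > 0) * y = max 0 (y :: real)"
  by (auto simp: max_def)

lemma zero_one_times_le_max: "p \<in> {0, 1} \<Longrightarrow> p * y \<le> max 0 (y :: real)"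
  by auto

text \<open>On the roots, \<open>u\<close> takes the pairwise differences of its partial sums
  \<open>t\<close>, so the bound on the roots says that \<open>t\<close> has spread at most
  \<open>\<beta>\<close>. As the entries of \<open>y\<close> sum to zero, \<open>t\<close> may be
  shifted to have minimum 0.\<close>

lemma support_gauge_A3: "support_gauge roots_A3 dual_vertices_A3 gauge_A3"
proof
  show "0 \<in> convex hull roots_A3"
  proof -
    have "(1 / 2) *\<^sub>R axis 0 1 + (1 / 2) *\<^sub>R (- axis 0 1) \<in> convex hull roots_A3"
      by (intro convexD[OF convex_convex_hull] hull_inc) (auto simp: roots_A3_def Let_def)
    then show ?thesis by simp
  qed
next
  fix u z :: "real ^ 3" and \<beta>
  assume u: "\<And>v. v \<in> roots_A3 \<Longrightarrow> u \<bullet> v \<le> \<beta>"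
  define t\<^sub>0 t\<^sub>1 t\<^sub>2 t\<^sub>3 :: real where t: "t\<^sub>0 = 0" "t\<^sub>1 = u $ 0" "t\<^sub>2 = u $ 0 + u $ 1" "t\<^sub>3 = u $ 0 + u $ 1 + u $ 2"
  have roots: "\<forall>v\<in>roots_A3. u \<bullet> v \<le> \<beta>" using u by blast
  have diff: "\<bar>u $ 0\<bar> \<le> \<beta>" "\<bar>u $ 1\<bar> \<le> \<beta>" "\<bar>u $ 2\<bar> \<le> \<beta>" "\<bar>u $ 0 + u $ 1\<bar> \<le> \<beta>" "\<bar>u $ 1 + u $ 2\<bar> \<le> \<beta>"
    "\<bar>u $ 0 + u $ 1 + u $ 2\<bar> \<le> \<beta>"
    using roots unfolding roots_A3_def Let_def abs_le_iff
    by (simp_all add: inner_3_zero axis_3_nth neq_3)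
  define m where "m = min (min (t\<^sub>0) (t\<^sub>1)) (min (t\<^sub>2) (t\<^sub>3))"
  have m: "m \<le> t\<^sub>0" "m \<le> t\<^sub>1" "m \<le> t\<^sub>2" "m \<le> t\<^sub>3"
    by (simp_all add: m_def)
  have M: "t\<^sub>0 \<le> m + \<beta>" "t\<^sub>1 \<le> m + \<beta>" "t\<^sub>2 \<le> m + \<beta>" "t\<^sub>3 \<le> m + \<beta>"
  proof -
    have "m = t\<^sub>0 \<or> m = t\<^sub>1 \<or> m = t\<^sub>2 \<or> m = t\<^sub>3"
      by (simp add: m_def min_def)
    then show "t\<^sub>0 \<le> m + \<beta>" "t\<^sub>1 \<le> m + \<beta>" "t\<^sub>2 \<le> m + \<beta>" "t\<^sub>3 \<le> m + \<beta>"
      using diff unfolding t abs_le_iff by (elim disjE; linarith)+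
  qed
  \<comment> \<open>The weights below meet the negated entries of \<open>y\<close>; because these
    sum to zero, their positive parts have the same sum as those of \<open>y\<close>.\<close>
  have neg: "max 0 (- y) = max 0 y - y" for y :: real
    by (simp add: max_def)
  have "u \<bullet> z = (t\<^sub>0 - m) * - z $ 0 + (t\<^sub>1 - m) * (z $ 0 - z $ 1) + (t\<^sub>2 - m) * (z $ 1 - z $ 2)
      + (t\<^sub>3 - m) * z $ 2"
    by (simp add: t inner_3_zero algebra_simps)
  also have "\<dots> \<le> \<beta> * max 0 (- z $ 0) + \<beta> * max 0 (z $ 0 - z $ 1) + \<beta> * max 0 (z $ 1 - z $ 2)
      + \<beta> * max 0 (z $ 2)"
    by (intro add_mono weighted_sum_le_positive_parts m M)
  also have "\<dots> = \<beta> * (max 0 (- z $ 0) + max 0 (z $ 0 - z $ 1) + max 0 (z $ 1 - z $ 2) + max 0 (z $ 2))"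
    by (simp add: distrib_left)
  also have "max 0 (- z $ 0) + max 0 (z $ 0 - z $ 1) + max 0 (z $ 1 - z $ 2) + max 0 (z $ 2) = gauge_A3 z"
    using neg[of "z $ 0"] neg[of "z $ 1 - z $ 0"] neg[of "z $ 2 - z $ 1"] neg[of "- z $ 2"]
    unfolding gauge_A3_def minus_diff_eq minus_minus by linarith
  finally show "u \<bullet> z \<le> \<beta> * gauge_A3 z" .
next
  fix w z :: "real ^ 3" assume "w \<in> dual_vertices_A3"
  then obtain x where x: "w = (\<lambda>(p, q, r, s). (p - q) *\<^sub>R axis 0 1 + (q - r) *\<^sub>R axis 1 1 + (r - s) *\<^sub>R axis 2 1) x"
    "x \<in> {0, 1} \<times> {0, 1} \<times> {0, 1} \<times> {0, 1}"
    unfolding dual_vertices_A3_def by (rule imageE)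
  obtain p q r s where "x = (p, q, r, s)"
    by (cases x)
  with x have w: "p \<in> {0, 1}" "q \<in> {0, 1}" "r \<in> {0, 1}" "s \<in> {0, 1}"
    "w = (p - q) *\<^sub>R axis 0 1 + (q - r) *\<^sub>R axis 1 1 + (r - s) *\<^sub>R axis 2 1"
    by auto
  have "w \<bullet> z = p * z $ 0 + q * (z $ 1 - z $ 0) + r * (z $ 2 - z $ 1) + s * (- z $ 2)"
    by (simp add: w inner_3_zero axis_3_nth neq_3 algebra_simps)
  also have "\<dots> \<le> gauge_A3 z"
    unfolding gauge_A3_def by (intro add_mono zero_one_times_le_max w)
  finally show "w \<bullet> z \<le> gauge_A3 z" .
next
  fix z :: "real ^ 3"
  \<comment> \<open>The maximising \<open>S\<close> consists of the positive entries of
    \<open>y\<close>.\<close>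
  define p q r s :: real where "p = of_bool (z $ 0 > 0)" and "q = of_bool (z $ 1 - z $ 0 > 0)"
    and "r = of_bool (z $ 2 - z $ 1 > 0)" and "s = of_bool (- z $ 2 > 0)"
  let ?w = "(p - q) *\<^sub>R axis 0 1 + (q - r) *\<^sub>R axis 1 1 + (r - s) *\<^sub>R axis 2 1 :: real ^ 3"
  have "?w \<bullet> z = p * z $ 0 + q * (z $ 1 - z $ 0) + r * (z $ 2 - z $ 1) + s * (- z $ 2)"
    by (simp add: inner_3_zero axis_3_nth neq_3 algebra_simps)
  also have "\<dots> = gauge_A3 z"
    unfolding gauge_A3_def p_def q_def r_def s_def of_bool_times_eq_max ..
  finally show "\<exists>w\<in>dual_vertices_A3. w \<bullet> z = gauge_A3 z"
    unfolding dual_vertices_A3_def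
  proof (rule bexI[of _ ?w], intro image_eqI[of _ _ "(p, q, r, s)"])
    have "(of_bool P :: real) \<in> {0, 1}" for P by simp
    then show "(p, q, r, s) \<in> {0, 1} \<times> {0, 1} \<times> {0, 1} \<times> {0, 1}"
      unfolding p_def q_def r_def s_def by blast
  qed simp
next
  have "\<forall>v\<in>roots_A3. gauge_A3 v \<le> 1"
    by (simp add: roots_A3_def Let_def gauge_A3_def axis_3_nth neq_3)
  then show "gauge_A3 v \<le> 1" if "v \<in> roots_A3" for v
    using that by blast
  show "finite roots_A3"
    unfolding roots_A3_def Let_def by (intro finite_UnI finite_imageI) simp_all
  show "finite dual_vertices_A3"
    unfolding dual_vertices_A3_def by (intro finite_imageI finite_cartesian_product) simp_all
qed

lemma root_polytope_A1: "root_polytope_A = convex hull {axis 1 1, - axis 1 1 :: real ^ 1}"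
proof -
  have "{(i, j). i \<le> j} = {(1, 1 :: 1)}"
    by (auto simp: num1_eq_iff)
  then show ?thesis
    by (simp add: root_polytope_A_def)
qed

text \<open>The segment from -1 to 1 is its own polar, so \<open>V\<close> and \<open>W\<close>
  coincide.\<close>

lemma support_gauge_A1:
  "support_gauge {axis 1 1, - axis 1 1 :: real ^ 1} {axis 1 1, - axis 1 1} (\<lambda>x. \<bar>x $ 1\<bar>)"
proof
  have "(1 / 2) *\<^sub>R axis 1 1 + (1 / 2) *\<^sub>R (- axis 1 1) \<in> convex hull {axis 1 1, - axis 1 1 :: real ^ 1}"
    by (intro convexD[OF convex_convex_hull] hull_inc) auto
  then show "0 \<in> convex hull {axis 1 1, - axis 1 1 :: real ^ 1}" by simp
next
  fix u z :: "real ^ 1" and \<beta>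
  assume u: "\<And>v. v \<in> {axis 1 1, - axis 1 1} \<Longrightarrow> u \<bullet> v \<le> \<beta>"
  have "\<bar>u $ 1\<bar> \<le> \<beta>"
    using u[of "axis 1 1"] u[of "- axis 1 1"] by (simp add: inner_vec_def axis_def)
  then have "\<bar>u $ 1 * z $ 1\<bar> \<le> \<beta> * \<bar>z $ 1\<bar>"
    by (simp add: abs_mult mult_right_mono)
  then show "u \<bullet> z \<le> \<beta> * \<bar>z $ 1\<bar>"
    by (simp add: inner_vec_def)
qed (auto simp: inner_vec_def axis_def abs_real_def)

section \<open>Delannoy numbers\<close>

fun delannoy :: "nat \<Rightarrow> nat \<Rightarrow> nat" where
  "delannoy 0 k = 1"
| "delannoy (Suc m) 0 = 1"
| "delannoy (Suc m) (Suc k) = delannoy (Suc m) k + delannoy m (Suc k) + delannoy m k"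

lemma delannoy_0_right [simp]: "delannoy m 0 = 1"
  by (cases m) auto

lemma delannoy_1: "delannoy (Suc 0) k = 2 * k + 1"
  by (induction k) auto

lemma delannoy_2: "delannoy (Suc (Suc 0)) k = 2 * k\<^sup>2 + 2 * k + 1"
  by (induction k) (auto simp: delannoy_1 power2_eq_square)

lemma delannoy_3: "3 * delannoy (Suc (Suc (Suc 0))) k = (2 * k + 1) * (2 * k\<^sup>2 + 2 * k + 3)"
  by (induction k) (auto simp: delannoy_1 delannoy_2 power2_eq_square algebra_simps)

text \<open>Slicing a cross-polytope by one coordinate: the value 0 leaves the \<open>k\<close>-th
  dilate, and each pair of opposite nonzero values leaves two copies of a smaller dilate.\<close>

lemma delannoy_Suc_eq_sum: "delannoy (Suc m) k = delannoy m k + 2 * (\<Sum>j<k. delannoy m j)"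
  by (induction k) auto

text \<open>The difference of both sides satisfies the recursion of the Delannoy numbers and vanishes on the
  boundary.\<close>

lemma delannoy_three_term:
  "(m + 2) * delannoy (Suc (Suc m)) k = (2 * k + 1) * delannoy (Suc m) k + (m + 1) * delannoy m k"
proof -
  define X :: "nat \<Rightarrow> nat \<Rightarrow> int" where
    "X m k = (int m + 2) * int (delannoy (Suc (Suc m)) k) - (2 * int k + 1) * int (delannoy (Suc m) k)
       - (int m + 1) * int (delannoy m k)" for m k
  \<comment> \<open>The coefficients in \<open>X\<close> vary with \<open>m\<close> and
    \<open>k\<close>, so linearity alone is not enough; the leftover terms cancel by further uses of
    the Delannoy recursion.\<close>
  have rec: "X (Suc m) (Suc k) = X (Suc m) k + X m (Suc k) + X m k" for m k
    unfolding X_def by (simp add: algebra_simps)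
  have "X m k = 0"
  proof (induction m arbitrary: k)
    case 0
    show ?case
      by (simp add: X_def delannoy_1 delannoy_2 power2_eq_square algebra_simps)
  next
    case (Suc m)
    show ?case
    proof (induction k)
      case 0
      show ?case by (simp add: X_def)
    next
      case (Suc k)
      then show ?case by (simp add: rec \<open>\<And>k. X m k = 0\<close>)
    qed
  qed
  then have "(int m + 2) * int (delannoy (Suc (Suc m)) k)
      = (2 * int k + 1) * int (delannoy (Suc m) k) + (int m + 1) * int (delannoy m k)"
    unfolding X_def by linarith
  then have "int ((m + 2) * delannoy (Suc (Suc m)) k)
      = int ((2 * k + 1) * delannoy (Suc m) k + (m + 1) * delannoy m k)"
    by (simp only: of_nat_mult of_nat_add of_nat_numeral of_nat_1)
  then show ?thesis by (simp only: of_nat_eq_iff)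
qed

text \<open>The three-term recurrence serves as the definition because it controls the ratios of
  consecutive polynomials at complex arguments.\<close>

fun delannoy_poly :: "nat \<Rightarrow> complex poly" where
  "delannoy_poly 0 = 1"
| "delannoy_poly (Suc 0) = [:1, 2:]"
| "delannoy_poly (Suc (Suc m)) =
     smult (1 / of_nat (m + 2)) ([:1, 2:] * delannoy_poly (Suc m) + smult (of_nat (m + 1)) (delannoy_poly m))"

lemma poly_delannoy_poly: "poly (delannoy_poly m) (of_nat k) = of_nat (delannoy m k)"
proof (induction m rule: delannoy_poly.induct)
  case (3 m)
  have "of_nat (m + 2) * poly (delannoy_poly (Suc (Suc m))) (of_nat k) =
      of_nat ((2 * k + 1) * delannoy (Suc m) k + (m + 1) * delannoy m k :: nat)"
    using 3 by (simp add: algebra_simps del: of_nat_Suc of_nat_add) (simp add: algebra_simps)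
  also have "\<dots> = of_nat (m + 2) * of_nat (delannoy (Suc (Suc m)) k)"
    unfolding delannoy_three_term[symmetric] by (simp only: of_nat_mult)
  finally show ?case
    using of_nat_neq_0[of "Suc m", where 'a = complex]
    by (simp add: numeral_2_eq_2 del: of_nat_add of_nat_Suc delannoy_poly.simps delannoy.simps)
qed (auto simp: delannoy_1)

section \<open>Half-planes and zeros\<close>

lemma Re_of_real_mult: "Re (of_real r * z) = r * Re z"
  by simp

text \<open>Inversion divides the real part by the squared modulus; the factor \<open>s\<close>
  treats the left and the right half-plane together.\<close>

lemma Re_inverse_same_sign:
  assumes "s * Re z > 0"
  shows "s * Re (inverse z) > 0"
proof -
  have "z \<noteq> 0"
    using assms by auto
  then have "(Re z)\<^sup>2 + (Im z)\<^sup>2 > 0"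
    by (simp add: complex_neq_0)
  then show ?thesis
    using assms by simp
qed

text \<open>If \<open>\<rho>\<close> is one ratio, the next is
  \<open>((2 z + 1) + (m + 1) / \<rho>) / (m + 2)\<close>, a positive combination of numbers in the
  same open half-plane.\<close>

lemma delannoy_poly_half_plane:
  fixes z :: complex
  defines "s \<equiv> Re (2 * z + 1)"
  assumes "s \<noteq> 0"
  shows "poly (delannoy_poly m) z \<noteq> 0 \<and>
    s * Re (poly (delannoy_poly (Suc m)) z / poly (delannoy_poly m) z) > 0"
proof (induction m)
  case 0
  show ?case
    using assms by (simp add: s_def algebra_simps flip: power2_eq_square)
next
  case (Suc m)
  define C where "C m = poly (delannoy_poly m) z" for m
  define \<rho> where "\<rho> = C (Suc m) / C m"
  have ih: "C m \<noteq> 0" "s * Re \<rho> > 0"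
    using Suc by (auto simp: C_def \<rho>_def)
  then have "\<rho> \<noteq> 0" by auto
  then have C1: "C (Suc m) \<noteq> 0"
    by (auto simp: \<rho>_def)
  have "C (Suc (Suc m)) = (1 / of_nat (m + 2)) * ((2 * z + 1) * C (Suc m) + of_nat (m + 1) * C m)"
    by (simp add: C_def algebra_simps)
  then have "C (Suc (Suc m)) / C (Suc m) = of_real (1 / real (m + 2)) * ((2 * z + 1) + of_real (real (m + 1)) * inverse \<rho>)"
    using C1 ih(1) by (simp add: \<rho>_def field_simps)
  then have "Re (C (Suc (Suc m)) / C (Suc m)) = (1 / real (m + 2)) * (s + real (m + 1) * Re (inverse \<rho>))"
    by (simp only: Re_of_real_mult s_def plus_complex.sel)
  then have "s * Re (C (Suc (Suc m)) / C (Suc m)) = (1 / real (m + 2)) * (s * s + real (m + 1) * (s * Re (inverse \<rho>)))"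
    by (simp only: distrib_left mult.left_commute)
  moreover have "real (m + 1) * (s * Re (inverse \<rho>)) > 0"
    using Re_inverse_same_sign[OF ih(2)] by (rule mult_pos_pos[rotated]) simp
  moreover have "s * s > 0"
    using assms by (metis not_real_square_gt_zero)
  ultimately have "s * Re (C (Suc (Suc m)) / C (Suc m)) > 0"
    using mult_pos_pos[OF _ add_pos_pos, of "1 / real (m + 2)"] by (simp only:) simp
  then show ?case using C1 by (simp add: C_def)
qed

text \<open>By the three-term recurrence, a zero would give
  \<open>5 (2 z + 1) + (2 m - 1) / \<rho> = 0\<close> for the ratio \<open>\<rho>\<close> of two consecutive Delannoy polynomials, which
  lies on the same side of the imaginary axis as \<open>2 z + 1\<close>.\<close>

lemma delannoy_combination_roots:
  assumes "m \<ge> 1"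
    and zero: "poly (smult (5 / 2) (delannoy_poly (m + 2)) - smult (3 / 2) (delannoy_poly m)) z = 0"
  shows "Re z = - 1 / 2"
proof (rule ccontr)
  assume "Re z \<noteq> - 1 / 2"
  define s where "s = Re (2 * z + 1)"
  have s: "s \<noteq> 0"
    using \<open>Re z \<noteq> - 1 / 2\<close> by (auto simp: s_def field_simps)
  define C where "C m = poly (delannoy_poly m) z" for m
  define \<rho> where "\<rho> = C (Suc m) / C m"
  have C: "C m \<noteq> 0" "C (Suc m) \<noteq> 0" and \<rho>: "s * Re \<rho> > 0"
    using delannoy_poly_half_plane[of z m] delannoy_poly_half_plane[of z "Suc m"] s
    by (auto simp: C_def \<rho>_def s_def)
  have "(of_nat m + 2) * C (Suc (Suc m)) = (2 * z + 1) * C (Suc m) + (of_nat m + 1) * C m"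
  proof -
    have "(of_nat m + 2 :: complex) \<noteq> 0"
      by (metis of_nat_eq_0_iff of_nat_add of_nat_numeral add_is_0 zero_neq_numeral)
    then show ?thesis by (simp add: C_def field_simps)
  qed
  moreover have "5 * C (Suc (Suc m)) = 3 * C m"
    using zero by (simp add: C_def numeral_2_eq_2 del: delannoy_poly.simps)
  \<comment> \<open>Five times the recurrence, with \<open>3 * C m\<close> substituted for
    \<open>5 * C (m + 2)\<close>; the coefficient is
    \<open>5 (m + 1) - 3 (m + 2) = 2 m - 1\<close>.\<close>
  ultimately have "5 * (2 * z + 1) * C (Suc m) + (2 * of_nat m - 1) * C m = 0"
    by algebra
  then have "5 * (2 * z + 1) + of_real (2 * real m - 1) * inverse \<rho> = 0"
    using C by (simp add: \<rho>_def field_simps)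
  then have "Re (5 * (2 * z + 1) + of_real (2 * real m - 1) * inverse \<rho>) = 0"
    by simp
  then have "5 * s + (2 * real m - 1) * Re (inverse \<rho>) = 0"
    by (simp only: Re_of_real_mult s_def plus_complex.sel) simp
  then have "s * (5 * s + (2 * real m - 1) * Re (inverse \<rho>)) = 0"
    by simp
  then have "5 * (s * s) + (2 * real m - 1) * (s * Re (inverse \<rho>)) = 0"
    by (simp only: distrib_left mult.left_commute)
  moreover have "s * Re (inverse \<rho>) > 0"
    using \<rho> by (rule Re_inverse_same_sign)
  \<comment> \<open>Here \<open>m \<ge> 1\<close> enters: it makes \<open>2 m - 1\<close>
    positive.\<close>
  then have "(2 * real m - 1) * (s * Re (inverse \<rho>)) > 0"
    by (rule mult_pos_pos[rotated]) (use assms(1) in linarith)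
  moreover have "s * s \<ge> 0" by simp
  ultimately show False by linarith
qed

section \<open>Lattice points\<close>

text \<open>Sum over the values of \<open>g\<close>. The fibre sizes cover both the absolute value
  of an integer and the distance to an integer interval.\<close>

lemma card_sum_le_fibres:
  fixes f :: "'a \<Rightarrow> nat" and g :: "'b \<Rightarrow> nat"
  assumes fin: "\<And>k. finite {x \<in> A. f x \<le> k}"
    and p: "card {y. g y = 0} = Suc p" and two: "\<And>i. card {y. g y = Suc i} = 2"
  shows "finite {(x, y). x \<in> A \<and> f x + g y \<le> k}"
    and "card {(x, y). x \<in> A \<and> f x + g y \<le> k}
      = Suc p * card {x \<in> A. f x \<le> k} + 2 * (\<Sum>j<k. card {x \<in> A. f x \<le> j})"
proof -
  define F where "F k = card {x \<in> A. f x \<le> k}" for k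
  \<comment> \<open>An infinite set has cardinality 0, so this also yields finiteness of the
    fibres.\<close>
  have "card {y. g y = i} > 0" for i
    using p two by (cases i) auto
  then have fin_g: "finite {y. g y = i}" for i
    by (simp add: card_gt_0_iff)
  have "{y. g y \<le> k} = (\<Union>i\<le>k. {y. g y = i})" by auto
  then have fin_gle: "finite {y. g y \<le> k}" using fin_g by simp
  let ?P = "SIGMA y:{y. g y \<le> k}. {x \<in> A. f x \<le> k - g y}"
  have eq: "{(x, y). x \<in> A \<and> f x + g y \<le> k} = prod.swap ` ?P"
    by (auto simp: image_iff)
  have finP: "finite ?P" using fin fin_gle by auto
  then show "finite {(x, y). x \<in> A \<and> f x + g y \<le> k}" unfolding eq by simp
  have "card {(x, y). x \<in> A \<and> f x + g y \<le> k} = card ?P"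
    unfolding eq by (rule card_image) simp
  also have "\<dots> = (\<Sum>y | g y \<le> k. F (k - g y))"
    using fin fin_gle by (simp add: F_def)
  also have "\<dots> = (\<Sum>i\<le>k. \<Sum>y | y \<in> {y. g y \<le> k} \<and> g y = i. F (k - g y))"
    by (rule sum.group[symmetric]) (use fin_gle in auto)
  also have "\<dots> = (\<Sum>i\<le>k. card {y. g y = i} * F (k - i))"
  proof (rule sum.cong)
    fix i assume "i \<in> {..k}"
    then have "{y. y \<in> {y. g y \<le> k} \<and> g y = i} = {y. g y = i}" by auto
    then show "(\<Sum>y | y \<in> {y. g y \<le> k} \<and> g y = i. F (k - g y)) = card {y. g y = i} * F (k - i)"
      by simp
  qed simp
  also have "\<dots> = Suc p * F k + (\<Sum>i<k. 2 * F (k - Suc i))"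
    unfolding sum.atMost_shift by (simp add: p two)
  also have "(\<Sum>i<k. 2 * F (k - Suc i)) = 2 * (\<Sum>j<k. F j)"
    unfolding sum_distrib_left[symmetric] by (simp add: sum.nat_diff_reindex)
  finally show "card {(x, y). x \<in> A \<and> f x + g y \<le> k} = Suc p * F k + 2 * (\<Sum>j<k. F j)" .
qed

text \<open>The distance from \<open>a\<close> to the interval with end points 0 and
  \<open>b\<close>, in either order; \<open>b = 0\<close> gives the absolute value, so
  cross-polytope coordinates are a special case.\<close>

definition interval_dist :: "int \<Rightarrow> int \<Rightarrow> nat" where
  "interval_dist b a = nat (max 0 (max (min 0 b - a) (a - max 0 b)))"

lemma card_interval_dist_0: "card {a. interval_dist b a = 0} = Suc (nat \<bar>b\<bar>)"
proof -
  have "{a. interval_dist b a = 0} = {min 0 b..max 0 b}"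
    by (auto simp: interval_dist_def)
  then show ?thesis by (auto simp: min_def max_def)
qed

lemma card_interval_dist_Suc: "card {a. interval_dist b a = Suc i} = 2"
proof -
  have "{a. interval_dist b a = Suc i} = {min 0 b - int (Suc i), max 0 b + int (Suc i)}"
    unfolding interval_dist_def by (auto simp: min_def max_def split: if_splits)
  then show ?thesis by auto
qed

lemma interval_dist_0: "interval_dist 0 a = nat \<bar>a\<bar>"
  by (auto simp: interval_dist_def)

text \<open>By \<open>delannoy_Suc_eq_sum\<close>, each new coordinate raises both dimensions by
  one, and by linearity the coefficients stay. Vectors indexed by \<open>I\<close> are functions
  vanishing off \<open>I\<close>, so that their type is fixed during the induction.\<close>

lemma card_cross_polytope_extension:
  fixes f :: "'a \<Rightarrow> nat" and \<alpha> \<beta> :: real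
  assumes fin: "\<And>k. finite {x. f x \<le> k}"
    and E: "\<And>k. real (card {x. f x \<le> k}) = \<alpha> * delannoy (Suc (Suc m)) k - \<beta> * delannoy m k"
    and I: "finite I"
  shows "finite {(x, t :: 'n \<Rightarrow> int). (\<forall>i. i \<notin> I \<longrightarrow> t i = 0) \<and> f x + (\<Sum>i\<in>I. nat \<bar>t i\<bar>) \<le> k} \<and>
    real (card {(x, t :: 'n \<Rightarrow> int). (\<forall>i. i \<notin> I \<longrightarrow> t i = 0) \<and> f x + (\<Sum>i\<in>I. nat \<bar>t i\<bar>) \<le> k})
      = \<alpha> * delannoy (Suc (Suc (m + card I))) k - \<beta> * delannoy (m + card I) k"
  using I
proof (induction I arbitrary: k rule: finite_induct)
  case empty
  have "bij_betw (\<lambda>x. (x, \<lambda>_. 0)) {x. f x \<le> k}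
     {(x, t :: 'n \<Rightarrow> int). (\<forall>i. i \<notin> {} \<longrightarrow> t i = 0) \<and> f x + (\<Sum>i\<in>{}. nat \<bar>t i\<bar>) \<le> k}"
    by (rule bij_betwI[of _ _ _ fst]) auto
  then show ?case
    using fin E by (simp add: bij_betw_same_card[symmetric] bij_betw_finite[symmetric])
next
  case (insert i I)
  define A where "A = {(x :: 'a, t :: 'n \<Rightarrow> int). \<forall>i. i \<notin> I \<longrightarrow> t i = 0}"
  define h where "h = (\<lambda>(x, t :: 'n \<Rightarrow> int). f x + (\<Sum>i\<in>I. nat \<bar>t i\<bar>))"
  have S: "{p \<in> A. h p \<le> k} = {(x, t). (\<forall>i. i \<notin> I \<longrightarrow> t i = 0) \<and> f x + (\<Sum>i\<in>I. nat \<bar>t i\<bar>) \<le> k}" for k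
    by (auto simp: A_def h_def)
  have fin: "finite {p \<in> A. h p \<le> k}"
    and card: "real (card {p \<in> A. h p \<le> k})
      = \<alpha> * delannoy (Suc (Suc (m + card I))) k - \<beta> * delannoy (m + card I) k" for k
    using insert.IH unfolding S by auto
  note * = card_sum_le_fibres[where A = A and f = h and g = "interval_dist 0", OF fin
      card_interval_dist_0 card_interval_dist_Suc, of k]
  \<comment> \<open>Splits off the value at \<open>i\<close>; the inverse resets it to 0 so that the
    remaining function vanishes off \<open>I\<close>.\<close>
  have bij: "bij_betw (\<lambda>((x, t), s). (x, t(i := s))) {(p, s). p \<in> A \<and> h p + interval_dist 0 s \<le> k}
     {(x, t :: 'n \<Rightarrow> int). (\<forall>j. j \<notin> insert i I \<longrightarrow> t j = 0) \<and> f x + (\<Sum>j\<in>insert i I. nat \<bar>t j\<bar>) \<le> k}"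
  proof (rule bij_betwI[of _ _ _ "\<lambda>(x, t). ((x, t(i := 0)), t i)"])
    have *: "(\<Sum>j\<in>I. nat \<bar>(t(i := s)) j\<bar>) = (\<Sum>j\<in>I. nat \<bar>t j\<bar>)" for t :: "'n \<Rightarrow> int" and s
      using insert.hyps by (intro sum.cong) auto
    then show "(\<lambda>((x, t), s). (x, t(i := s))) \<in> {(p, s). p \<in> A \<and> h p + interval_dist 0 s \<le> k} \<rightarrow>
     {(x, t). (\<forall>j. j \<notin> insert i I \<longrightarrow> t j = 0) \<and> f x + (\<Sum>j\<in>insert i I. nat \<bar>t j\<bar>) \<le> k}"
      using insert.hyps by (auto simp: A_def h_def interval_dist_0 simp del: fun_upd_apply) (auto simp: fun_upd_apply)
    show "(\<lambda>(x, t). ((x, t(i := 0)), t i)) \<in>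
     {(x, t). (\<forall>j. j \<notin> insert i I \<longrightarrow> t j = 0) \<and> f x + (\<Sum>j\<in>insert i I. nat \<bar>t j\<bar>) \<le> k} \<rightarrow>
       {(p, s). p \<in> A \<and> h p + interval_dist 0 s \<le> k}"
      using insert.hyps * by (auto simp: A_def h_def interval_dist_0 simp del: fun_upd_apply) (auto simp: fun_upd_apply)
  qed (use insert.hyps in \<open>auto simp: A_def fun_eq_iff\<close>)
  have "real (card {(p, s). p \<in> A \<and> h p + interval_dist 0 s \<le> k})
      = real (card {p \<in> A. h p \<le> k}) + 2 * (\<Sum>j<k. real (card {p \<in> A. h p \<le> j}))"
    unfolding *(2) by simp
  also have "\<dots> = \<alpha> * delannoy (Suc (Suc (m + card (insert i I)))) k - \<beta> * delannoy (m + card (insert i I)) k"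
    using insert.hyps
    by (simp add: card delannoy_Suc_eq_sum[of _ k] sum_subtractf sum_distrib_left algebra_simps
        del: delannoy.simps)
  finally show ?case
    using *(1) bij_betw_same_card[OF bij] bij_betw_finite[OF bij] by simp
qed

text \<open>Two uses of \<open>card_sum_le_fibres\<close> with \<open>p = \<bar>b\<bar>\<close>:
  from a one-point set the first gives \<open>p + 1 + 2 k\<close> values of \<open>c\<close>, the
  second adds \<open>a\<close>.\<close>

lemma card_A3_layer:
  "real (card {(c, a). interval_dist b c + interval_dist b a \<le> k})
    = (real (nat \<bar>b\<bar>) + 1)\<^sup>2 + 4 * (real (nat \<bar>b\<bar>) + 1) * real k + 2 * real k * (real k - 1)"
  "finite {(c, a). interval_dist b c + interval_dist b a \<le> k}"
proof -
  have 1: "finite {u :: unit \<in> UNIV. 0 \<le> k}" for k :: nat by simp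
  note c1 = card_sum_le_fibres[where A = UNIV and f = "\<lambda>_::unit. 0" and g = "interval_dist b",
      OF 1 card_interval_dist_0 card_interval_dist_Suc]
  have bij: "bij_betw snd {(x :: unit, y). x \<in> UNIV \<and> 0 + interval_dist b y \<le> k} {c. interval_dist b c \<le> k}" for k
    by (rule bij_betwI[of _ _ _ "Pair ()"]) auto
  have fin: "finite {c \<in> UNIV. interval_dist b c \<le> k}" for k
    using bij_betw_finite[OF bij] c1(1) by simp
  have card: "card {c \<in> UNIV. interval_dist b c \<le> k} = Suc (nat \<bar>b\<bar>) + 2 * k" for k
    using bij_betw_same_card[OF bij, of k] c1(2)[of k] by simp
  note c2 = card_sum_le_fibres[where A = UNIV and f = "interval_dist b" and g = "interval_dist b",
      OF fin card_interval_dist_0 card_interval_dist_Suc, of k]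
  show "finite {(c, a). interval_dist b c + interval_dist b a \<le> k}" using c2(1) by simp
  have gauss: "2 * (\<Sum>j<k. real j) = k * (real k - 1)" for k :: nat
    by (induction k) (auto simp: algebra_simps)
  have "real (card {(c, a). interval_dist b c + interval_dist b a \<le> k})
      = real (Suc (nat \<bar>b\<bar>) * (Suc (nat \<bar>b\<bar>) + 2 * k) + 2 * (\<Sum>j<k. Suc (nat \<bar>b\<bar>) + 2 * j))"
    using c2(2) unfolding card by simp
  also have "\<dots> = (real (nat \<bar>b\<bar>) + 1) * (real (nat \<bar>b\<bar>) + 1 + 2 * k) +
      2 * (k * (real (nat \<bar>b\<bar>) + 1) + 2 * (\<Sum>j<k. real j))"
    by (simp add: sum.distrib sum_distrib_left algebra_simps)
  finally show "real (card {(c, a). interval_dist b c + interval_dist b a \<le> k})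
    = (real (nat \<bar>b\<bar>) + 1)\<^sup>2 + 4 * (real (nat \<bar>b\<bar>) + 1) * real k + 2 * real k * (real k - 1)"
    unfolding gauss by (simp add: power2_eq_square algebra_simps)
qed

text \<open>The gauge of \<open>A\<^sub>3\<close> at \<open>(a, b, c)\<close>: for fixed \<open>b\<close>, the contributions of \<open>a\<close> and \<open>c\<close> are
  independent, because \<open>\<bar>a\<bar> + \<bar>b - a\<bar>\<close> is \<open>\<bar>b\<bar>\<close> plus twice the distance of \<open>a\<close> from the interval
  between \<open>0\<close> and \<open>b\<close>.\<close>

definition height_A3 :: "int \<times> int \<times> int \<Rightarrow> nat" where
  "height_A3 = (\<lambda>(b, a, c). nat \<bar>b\<bar> + interval_dist b a + interval_dist b c)"

lemma sum_symmetric_interval: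
  fixes h :: "nat \<Rightarrow> real"
  shows "(\<Sum>b\<in>{- int k..int k}. h (nat \<bar>b\<bar>)) = h 0 + 2 * (\<Sum>j<k. h (Suc j))"
proof (induction k)
  case (Suc k)
  have "{- int (Suc k)..int (Suc k)} = insert (int (Suc k)) (insert (- int (Suc k)) {- int k..int k})"
    by auto
  then show ?case using Suc by (simp add: algebra_simps nat_add_distrib)
qed simp

text \<open>The layer at height \<open>b\<close> has the bound \<open>k - \<bar>b\<bar>\<close> left
  for \<open>a\<close> and \<open>c\<close>; summing the layers gives a cubic in \<open>k\<close>, a
  combination of the Delannoy polynomials of dimensions 3 and 1.\<close>

lemma card_height_A3:
  shows "finite {x. height_A3 x \<le> k}"
    and "real (card {x. height_A3 x \<le> k})
      = 5 / 2 * delannoy (Suc (Suc (Suc 0))) k - 3 / 2 * delannoy (Suc 0) k"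
proof -
  let ?L = "\<lambda>b. {(a, c). interval_dist b a + interval_dist b c \<le> k - nat \<bar>b\<bar>}"
  have eq: "{x. height_A3 x \<le> k} = (SIGMA b:{- int k..int k}. ?L b)"
    by (auto simp: height_A3_def)
  show "finite {x. height_A3 x \<le> k}"
    unfolding eq using card_A3_layer(2) by auto
  define G where "G \<beta> = (real \<beta> + 1)\<^sup>2 + 4 * (real \<beta> + 1) * (real k - \<beta>) + 2 * (real k - \<beta>) * (real k - \<beta> - 1)" for \<beta> :: nat
  \<comment> \<open>Expanded, \<open>G \<beta>\<close> is
    \<open>2 k^2 + 2 k + 1 - \<beta>^2\<close>, so this is a sum of squares. The limit
    \<open>m\<close> is kept apart from the \<open>k\<close> inside \<open>G\<close> to allow
    induction.\<close>
  have sum_G: "6 * (\<Sum>j<m. G (Suc j)) =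
      - (real m - 1) * m * (2 * real m - 1) - 6 * m * (real m - 1) + 12 * m * (real k ^ 2 + real k)" for m
    by (induction m) (simp_all add: G_def power2_eq_square algebra_simps)
  have "real (card {x. height_A3 x \<le> k}) = (\<Sum>b\<in>{- int k..int k}. real (card (?L b)))"
    unfolding eq by (subst card_SigmaI) (use card_A3_layer(2) in auto)
  also have "\<dots> = (\<Sum>b\<in>{- int k..int k}. G (nat \<bar>b\<bar>))"
  proof (rule sum.cong)
    fix b assume "b \<in> {- int k..int k}"
    then have "nat \<bar>b\<bar> \<le> k" by auto
    then show "real (card (?L b)) = G (nat \<bar>b\<bar>)"
      unfolding card_A3_layer(1) G_def by (simp add: of_nat_diff)
  qed simp
  also have "\<dots> = G 0 + 2 * (\<Sum>j<k. G (Suc j))"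
    by (rule sum_symmetric_interval)
  also have "\<dots> = (2 * real k + 1) * (5 * real k ^ 2 + 5 * real k + 3) / 3"
    using sum_G[of k] by (simp add: G_def power2_eq_square algebra_simps)
  also have "\<dots> = 5 / 2 * delannoy (Suc (Suc (Suc 0))) k - 3 / 2 * delannoy (Suc 0) k"
  proof -
    have "3 * real (delannoy (Suc (Suc (Suc 0))) k) = (2 * real k + 1) * (2 * real k ^ 2 + 2 * real k + 3)"
      using arg_cong[OF delannoy_3[of k], of real] by (simp only: of_nat_mult of_nat_add of_nat_power of_nat_numeral of_nat_1)
    moreover have "real (delannoy (Suc 0) k) = 2 * real k + 1"
      by (simp add: delannoy_1)
    ultimately show ?thesis by (simp add: power2_eq_square field_simps)
  qed
  finally show "real (card {x. height_A3 x \<le> k})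
      = 5 / 2 * delannoy (Suc (Suc (Suc 0))) k - 3 / 2 * delannoy (Suc 0) k" .
qed

section \<open>The Ehrhart polynomial\<close>

text \<open>Polynomials that agree at infinitely many integers coincide, which settles the
  uniqueness in the definite description.\<close>

lemma ehrhart_poly_eqI:
  assumes "\<And>k::nat. k \<ge> 1 \<Longrightarrow>
    poly p (of_nat k) = of_nat (card ((\<lambda>x. real k *\<^sub>R x) ` Q \<inter> integer_points))"
  shows "ehrhart_poly Q = p"
  unfolding ehrhart_poly_def
proof (rule the_equality)
  fix q :: "complex poly"
  assume q: "\<forall>k::nat. k \<ge> 1 \<longrightarrow>
    poly q (of_nat k) = of_nat (card ((\<lambda>x. real k *\<^sub>R x) ` Q \<inter> integer_points))"
  have "of_nat ` {1..} \<subseteq> {x. poly (q - p) x = 0}"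
    using assms q by auto
  moreover have "infinite ((of_nat :: nat \<Rightarrow> complex) ` {1..})"
    by (subst finite_image_iff) (auto simp: inj_on_def infinite_Ici)
  ultimately have "infinite {x. poly (q - p) x = 0}"
    by (rule infinite_super)
  then show "q = p"
    using poly_roots_finite[of "q - p"] by (cases "q - p = 0") simp_all
qed (use assms in blast)

section \<open>Integrality of the vertices\<close>

lemma integer_points_real: "(x :: real) \<in> integer_points \<longleftrightarrow> x \<in> \<int>"
  by (simp add: integer_points_def)

lemma integer_points_Pair: "(x, y) \<in> integer_points \<longleftrightarrow> x \<in> integer_points \<and> y \<in> integer_points"
  by (simp add: integer_points_def Basis_prod_def ball_Un)

lemma integer_points_Times:
  "A \<subseteq> integer_points \<Longrightarrow> B \<subseteq> integer_points \<Longrightarrow> A \<times> B \<subseteq> integer_points"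
  by (auto simp: integer_points_Pair)

lemma integer_points_vec: "x \<in> integer_points \<longleftrightarrow> (\<forall>i. x $ i \<in> integer_points)"
  for x :: "'a::euclidean_space ^ 'n"
  by (auto simp: integer_points_def Basis_vec_def inner_axis)

lemma integer_points_zero: "0 \<in> integer_points"
  by (simp add: integer_points_def)

lemma integer_points_axis: "v \<in> integer_points \<Longrightarrow> axis i v \<in> integer_points"
  unfolding integer_points_vec[of "axis i v"] by (simp add: axis_def integer_points_zero)

lemma integer_points_axis_1: "axis i 1 \<in> (integer_points :: (real ^ 'n) set)"
  by (simp add: integer_points_axis integer_points_real)

lemma integer_points_uminus: "x \<in> integer_points \<Longrightarrow> - x \<in> integer_points"
  by (simp add: integer_points_def)

lemma integer_points_add:
  "x \<in> integer_points \<Longrightarrow> y \<in> integer_points \<Longrightarrow> x + y \<in> integer_points"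
  by (simp add: integer_points_def inner_add_left)

lemma integer_points_scaleR: "c \<in> \<int> \<Longrightarrow> x \<in> integer_points \<Longrightarrow> c *\<^sub>R x \<in> integer_points"
  by (simp add: integer_points_def)

lemma roots_A3_integer: "roots_A3 \<subseteq> integer_points"
  unfolding roots_A3_def Let_def
  by (intro Un_least image_subsetI integer_points_uminus)
    (auto intro: integer_points_add integer_points_axis_1)

lemma dual_vertices_A3_integer: "dual_vertices_A3 \<subseteq> integer_points"
  unfolding dual_vertices_A3_def
proof (intro image_subsetI, clarify)
  fix p q r s :: real
  assume "p \<in> {0, 1}" "q \<in> {0, 1}" "r \<in> {0, 1}" "s \<in> {0, 1}"
  then have "p \<in> \<int>" "q \<in> \<int>" "r \<in> \<int>" "s \<in> \<int>" by auto
  then show "(p - q) *\<^sub>R axis 0 1 + (q - r) *\<^sub>R axis 1 1 + (r - s) *\<^sub>R axis 2 1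
      \<in> (integer_points :: (real ^ 3) set)"
    by (intro integer_points_add integer_points_scaleR integer_points_axis_1 Ints_diff)
qed

section \<open>From the gauge to the integer height\<close>

lemma height_A3_eq:
  "2 * int (height_A3 (b, a, c)) = \<bar>a\<bar> + \<bar>b - a\<bar> + \<bar>c - b\<bar> + \<bar>c\<bar>"
proof -
  have "2 * int (interval_dist b x) + \<bar>b\<bar> = \<bar>x\<bar> + \<bar>b - x\<bar>" for x
    by (auto simp: interval_dist_def max_def min_def)
  from this[of a] this[of c] show ?thesis
    by (simp add: height_A3_def abs_minus_commute[of c])
qed

text \<open>The entries of \<open>y\<close> sum to zero, so their positive parts make up half of the
  sum of absolute values.\<close>

lemma gauge_A3_eq_half_sum_abs:
  "2 * gauge_A3 x = \<bar>x $ 0\<bar> + \<bar>x $ 1 - x $ 0\<bar> + \<bar>x $ 2 - x $ 1\<bar> + \<bar>x $ 2\<bar>"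
proof -
  have "2 * max 0 y = \<bar>y\<bar> + y" for y :: real
    by (simp add: max_def)
  then show ?thesis
    by (simp add: gauge_A3_def distrib_left)
qed

lemma gauge_A3_of_int:
  assumes "x $ 0 = of_int a" "x $ 1 = of_int b" "x $ 2 = of_int c"
  shows "gauge_A3 x = real (height_A3 (b, a, c))"
proof -
  have "2 * gauge_A3 x = real_of_int (2 * int (height_A3 (b, a, c)))"
    unfolding gauge_A3_eq_half_sum_abs height_A3_eq assms by simp
  then show ?thesis by simp
qed

lemma of_int_floor: "x \<in> \<int> \<Longrightarrow> of_int \<lfloor>x\<rfloor> = x"
  by (auto elim: Ints_cases)

text \<open>On lattice points the gauge is the integer height plus absolute values, so the count
  extends that of \<open>A_3\<close> by \<open>CARD('n)\<close> coordinates, starting at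
  \<open>m = 1\<close>.\<close>

lemma card_lattice_points:
  fixes \<nu> :: "(real ^ 3) \<times> (real ^ 1 ^ 'n::finite) \<Rightarrow> real"
  defines "\<nu> \<equiv> \<lambda>(x, y). gauge_A3 x + (\<Sum>i\<in>UNIV. \<bar>y $ i $ 1\<bar>)"
  shows "real (card ({z. \<nu> z \<le> real k} \<inter> integer_points))
    = 5 / 2 * delannoy (CARD('n) + 3) k - 3 / 2 * delannoy (CARD('n) + 1) k"
proof -
  let ?S = "{(x, t :: 'n \<Rightarrow> int). (\<forall>i. i \<notin> UNIV \<longrightarrow> t i = 0) \<and> height_A3 x + (\<Sum>i\<in>UNIV. nat \<bar>t i\<bar>) \<le> k}"
  \<comment> \<open>The middle coordinate \<open>b\<close> comes first in the triple, as in
    \<open>height_A3\<close>, which is sliced by it.\<close>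
  define \<phi> :: "(int \<times> int \<times> int) \<times> ('n \<Rightarrow> int) \<Rightarrow> (real ^ 3) \<times> (real ^ 1 ^ 'n)" where
    "\<phi> = (\<lambda>((b, a, c), t). (axis 0 (of_int a) + axis 1 (of_int b) + axis 2 (of_int c), \<chi> i j. of_int (t i)))"
  define \<psi> :: "(real ^ 3) \<times> (real ^ 1 ^ 'n) \<Rightarrow> (int \<times> int \<times> int) \<times> ('n \<Rightarrow> int)" where
    "\<psi> = (\<lambda>(x, y). ((\<lfloor>x $ 1\<rfloor>, \<lfloor>x $ 0\<rfloor>, \<lfloor>x $ 2\<rfloor>), \<lambda>i. \<lfloor>y $ i $ 1\<rfloor>))"
  have \<nu>: "\<nu> (\<phi> (x, t)) = real (height_A3 x + (\<Sum>i\<in>UNIV. nat \<bar>t i\<bar>))" for x t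
  proof -
    obtain b a c where x: "x = (b, a, c)" by (cases x)
    have "gauge_A3 (axis 0 (of_int a) + axis 1 (of_int b) + axis 2 (of_int c)) = real (height_A3 (b, a, c))"
      by (rule gauge_A3_of_int) (simp_all add: axis_def neq_3)
    then show ?thesis by (simp add: \<nu>_def \<phi>_def x)
  qed
  have \<psi>\<phi>: "\<psi> (\<phi> p) = p" for p
    by (cases p) (auto simp: \<psi>_def \<phi>_def axis_def neq_3)
  have \<phi>\<psi>: "\<phi> (\<psi> z) = z" if "z \<in> integer_points" for z
  proof -
    obtain x y where z: "z = (x, y)" by (cases z)
    have "x $ i \<in> \<int>" "y $ j $ 1 \<in> \<int>" for i j
      using that unfolding z integer_points_Pair integer_points_vec integer_points_real by auto
    then show ?thesis
      unfolding z by (simp add: \<psi>_def \<phi>_def vec_eq_iff forall_3_zero axis_def neq_3 forall_1 of_int_floor)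
  qed
  have "\<phi> p \<in> integer_points" for p
    by (cases p) (auto simp: \<phi>_def integer_points_Pair integer_points_vec integer_points_real axis_def)
  then have "bij_betw \<phi> ?S ({z. \<nu> z \<le> real k} \<inter> integer_points)"
  proof (intro bij_betwI[of _ _ _ \<psi>])
    show "\<psi> \<in> {z. \<nu> z \<le> real k} \<inter> integer_points \<rightarrow> ?S"
    proof
      fix z assume z: "z \<in> {z. \<nu> z \<le> real k} \<inter> integer_points"
      then have "\<nu> (\<phi> (\<psi> z)) \<le> real k" by (simp add: \<phi>\<psi>)
      then show "\<psi> z \<in> ?S"
        by (cases "\<psi> z") (simp only: \<nu> of_nat_le_iff, simp)
    qed
  qed (auto simp: \<nu> \<psi>\<phi> \<phi>\<psi> simp del: of_nat_add of_nat_sum)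
  then have "card ({z. \<nu> z \<le> real k} \<inter> integer_points) = card ?S"
    by (simp add: bij_betw_same_card)
  moreover have "real (card ?S) = 5 / 2 * delannoy (Suc (Suc (Suc 0 + CARD('n)))) k - 3 / 2 * delannoy (Suc 0 + CARD('n)) k"
    using card_cross_polytope_extension[OF card_height_A3(1) card_height_A3(2) finite[of "UNIV :: 'n set"]] by blast
  ultimately show ?thesis
    by (simp add: numeral_3_eq_3)
qed

theorem theorem5:
  shows "CL_polytope (free_sum (root_polytope_A :: (real ^ 3) set)
           (free_power (root_polytope_A :: (real ^ 1) set) :: (real ^ 1 ^ 'n::finite) set))"
proof -
  let ?S = "{axis 1 1, - axis 1 1 :: real ^ 1}"
  let ?V = "roots_A3 \<times> {0} \<union> {0} \<times> (\<Union>i::'n. axis i ` ?S)"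
  let ?W = "dual_vertices_A3 \<times> {w :: real ^ 1 ^ 'n. \<forall>i. w $ i \<in> ?S}"
  let ?\<nu> = "\<lambda>(x, y :: real ^ 1 ^ 'n). gauge_A3 x + (\<Sum>i\<in>UNIV. \<bar>y $ i $ 1\<bar>)"
  let ?Q = "free_sum (root_polytope_A :: (real ^ 3) set)
           (free_power (root_polytope_A :: (real ^ 1) set) :: (real ^ 1 ^ 'n) set)"
  interpret support_gauge ?V ?W ?\<nu>
    by (intro support_gauge_free_sum support_gauge_free_power support_gauge_A3 support_gauge_A1)
  have Q: "?Q = convex hull ?V"
    unfolding root_polytope_A3 root_polytope_A1 free_power_convex_hull free_sum_convex_hull ..
  have S: "?S \<subseteq> integer_points"
    by (simp add: integer_points_axis_1 integer_points_uminus)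
  have "?V \<subseteq> integer_points"
    by (intro Un_least integer_points_Times roots_A3_integer UN_least image_subsetI integer_points_axis
        subsetD[OF S]) (simp_all add: integer_points_zero)
  moreover have "?W \<subseteq> integer_points"
    by (intro integer_points_Times dual_vertices_A3_integer) (use S in \<open>blast intro: integer_points_vec[THEN iffD2]\<close>)
  ultimately have "reflexive ?Q"
    unfolding Q by (rule reflexive_hull)
  \<comment> \<open>The indices are written as \<open>m + 2\<close> and \<open>m\<close> with
    \<open>m = CARD('n) + 1\<close>, the form in which \<open>delannoy_combination_roots\<close>
    locates the zeros.\<close>
  moreover have "ehrhart_poly ?Q
      = smult (5 / 2) (delannoy_poly (CARD('n) + 1 + 2)) - smult (3 / 2) (delannoy_poly (CARD('n) + 1))"
  proof (rule ehrhart_poly_eqI)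
    fix k :: nat assume "k \<ge> 1"
    then have "(\<lambda>x. real k *\<^sub>R x) ` ?Q = {z. ?\<nu> z \<le> real k}"
      unfolding Q by (intro scaled_hull) simp
    then have "real (card ((\<lambda>x. real k *\<^sub>R x) ` ?Q \<inter> integer_points))
        = 5 / 2 * real (delannoy (CARD('n) + 3) k) - 3 / 2 * real (delannoy (CARD('n) + 1) k)"
      using card_lattice_points[where 'n = 'n, of k] by simp
    then have "complex_of_real (real (card ((\<lambda>x. real k *\<^sub>R x) ` ?Q \<inter> integer_points)))
        = complex_of_real (5 / 2 * real (delannoy (CARD('n) + 3) k) - 3 / 2 * real (delannoy (CARD('n) + 1) k))"
      by (rule arg_cong)
    then show "poly (smult (5 / 2) (delannoy_poly (CARD('n) + 1 + 2)) - smult (3 / 2) (delannoy_poly (CARD('n) + 1))) (of_nat k)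
        = of_nat (card ((\<lambda>x. real k *\<^sub>R x) ` ?Q \<inter> integer_points))"
      by (simp add: poly_delannoy_poly numeral_3_eq_3 numeral_2_eq_2 del: delannoy.simps delannoy_poly.simps)
  qed
  ultimately show ?thesis
    unfolding CL_polytope_def using delannoy_combination_roots[of "CARD('n) + 1"] by simp
qed

end
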